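(* There exists an absolute constant $C>0$ such that for every allocation process satisfying Condition $\mathcal{P}$ and Condition $\mathcal{W}$ (defined in the context) and every round $m\geq 1$, \[ \Pr\big[\mathrm{Gap}(m)\leq C\log n\big]\geq 1-n^{-2}. \]
   Context: There are $n$ bins. An allocation process proceeds in rounds $t=0,1,2,\dots$; $x^t=(x^t_1,\dots,x^t_n)\in\mathbb{Z}_{\ge 0}^n$ is the load vector after $t$ rounds, with $x^0=(0,\dots,0)$. In each round every bin's load increases by a non-negative integer and at least one ball is allocated in total. Let $W^t=\sum_{i=1}^n x_i^t$, let the normalized load be $y_i^t=x_i^t-W^t/n$, let $B_-^t=\{i:y_i^t<0\}$ (underloaded bins) and $B_+^t=[n]\setminus B_-^t$. The gap is $\mathrm{Gap}(t)=\max_{i}x_i^t-W^t/n$. $\mathfrak{F}^t$ denotes the filtration (history) of the first $t$ rounds. Condition $\mathcal{P}$: in each round $t$, label the bins so that $y_1^t\ge y_2^t\ge\cdots\ge y_n^t$; a bin $i=i^t$ is sampled according to a probability vector $p^t$ (which may depend on $\mathfrak{F}^t$) that is majorized by the uniform distribution, i.e. $\sum_{j=1}^k p_j^t\le k/n$ for all $k\in[n]$. Condition $\mathcal{W}$: in each round $t$, with $i$ the sampled bin: if $y_i^t\ge 0$, a single ball is allocated to bin $i$; if $y_i^t<0$, exactly $\lceil -y_i^t\rceil+1$ balls are allocated to bins of $B_-^t$ (in a way that may depend on $\mathfrak{F}^t$) such that at most one bin $k_1\in B_-^t$ receives $\lceil -y_{k_1}^t\rceil+1$ balls, at most one bin $k_2\in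 B_-^t$ receives $\lceil -y_{k_2}^t\rceil$ balls, and every other bin $j\in B_-^t$ receives at most $\lceil -y_j^t\rceil-1$ balls. Convention: statements are asserted for all sufficiently large $n$. *)

theory Defs
  imports "HOL-Probability.Probability"
begin

text \<open>
  The bins are \<open>{1..n}\<close>. The field \<open>internal\<close> encodes any further random choice made in a round
  (the content of a cache, say), so that later rounds may depend on more of the past than the
  samples and the allocations.
\<close>

datatype outcome =
  Outcome (sampled: nat) (received: "nat \<Rightarrow> nat") (internal: nat)

text \<open>Oldest round first.\<close>

type_synonym history = "outcome list"

definition load :: "history \<Rightarrow> nat \<Rightarrow> nat" where
  "load h i = (\<Sum>r\<leftarrow>h. received r i)"

definition total_load :: "nat \<Rightarrow> history \<Rightarrow> nat" where
  "total_load n h = (\<Sum>i\<in>{1..n}. load h i)"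

definition normalized_load :: "nat \<Rightarrow> history \<Rightarrow> nat \<Rightarrow> real" where
  "normalized_load n h i = real (load h i) - real (total_load n h) / real n"

definition underloaded_bins :: "nat \<Rightarrow> history \<Rightarrow> nat set" where
  "underloaded_bins n h = {i \<in> {1..n}. normalized_load n h i < 0}"

definition overloaded_bins :: "nat \<Rightarrow> history \<Rightarrow> nat set" where
  "overloaded_bins n h = {1..n} - underloaded_bins n h"

definition gap :: "nat \<Rightarrow> history \<Rightarrow> real" where
  "gap n h = real (Max (load h ` {1..n})) - real (total_load n h) / real n"

text \<open>
  A process is given by a kernel \<open>K\<close>: \<open>K h\<close> is the joint conditional law of the sample, the
  allocation and the internal choices of the next round, given the history \<open>h\<close>. Hence everything
  may depend on the history, and the allocation also on the sampled bin and on fresh randomness.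
\<close>

primrec history_pmf :: "(history \<Rightarrow> outcome pmf) \<Rightarrow> nat \<Rightarrow> history pmf" where
  "history_pmf K 0 = return_pmf []"
| "history_pmf K (Suc t) =
     bind_pmf (history_pmf K t) (\<lambda>h. map_pmf (\<lambda>r. h @ [r]) (K h))"

definition allocation_process :: "nat \<Rightarrow> (history \<Rightarrow> outcome pmf) \<Rightarrow> bool" where
  "allocation_process n K \<longleftrightarrow>
     (\<forall>t. \<forall>h \<in> set_pmf (history_pmf K t). \<forall>r \<in> set_pmf (K h).
        (\<Sum>j\<in>{1..n}. received r j) \<ge> 1 \<and> (\<forall>j. j \<notin> {1..n} \<longrightarrow> received r j = 0))"

definition sampling_pmf :: "(history \<Rightarrow> outcome pmf) \<Rightarrow> history \<Rightarrow> nat pmf" where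
  "sampling_pmf K h = map_pmf sampled (K h)"

text \<open>
  The bins keep their names throughout; \<open>\<sigma> j\<close> is the bin that gets the label \<open>j\<close> when they are
  sorted by load. Ties may be broken in any way.
\<close>

definition condition_P :: "nat \<Rightarrow> (history \<Rightarrow> outcome pmf) \<Rightarrow> bool" where
  "condition_P n K \<longleftrightarrow>
     (\<forall>t. \<forall>h \<in> set_pmf (history_pmf K t).
        set_pmf (sampling_pmf K h) \<subseteq> {1..n} \<and>
        (\<exists>\<sigma>. bij_betw \<sigma> {1..n} {1..n} \<and>
             (\<forall>j\<in>{1..n}. \<forall>k\<in>{1..n}. j \<le> k \<longrightarrow>
                normalized_load n h (\<sigma> j) \<ge> normalized_load n h (\<sigma> k)) \<and>
             (\<forall>k\<in>{1..n}. (\<Sum>j\<in>{1..k}. pmf (sampling_pmf K h) (\<sigma> j)) \<le> real k / real n)))"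

text \<open>
  The bounds are compared as integers, so that \<open>\<lceil>- y\<rceil> - 1\<close> is not truncated.
\<close>

definition condition_W_round :: "nat \<Rightarrow> history \<Rightarrow> nat \<Rightarrow> (nat \<Rightarrow> nat) \<Rightarrow> bool" where
  "condition_W_round n h i a \<longleftrightarrow>
     (let y = normalized_load n h; B = underloaded_bins n h in
        (y i \<ge> 0 \<longrightarrow> (\<forall>j\<in>{1..n}. a j = (if j = i then 1 else 0))) \<and>
        (y i < 0 \<longrightarrow>
           int (\<Sum>j\<in>B. a j) = \<lceil>- y i\<rceil> + 1 \<and>
           (\<forall>j\<in>overloaded_bins n h. a j = 0) \<and>
           card {j \<in> B. int (a j) = \<lceil>- y j\<rceil> + 1} \<le> 1 \<and>
           card {j \<in> B. int (a j) = \<lceil>- y j\<rceil>} \<le> 1 \<and>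
           (\<forall>j\<in>B. int (a j) = \<lceil>- y j\<rceil> + 1 \<or> int (a j) = \<lceil>- y j\<rceil> \<or> int (a j) \<le> \<lceil>- y j\<rceil> - 1)))"

definition condition_W :: "nat \<Rightarrow> (history \<Rightarrow> outcome pmf) \<Rightarrow> bool" where
  "condition_W n K \<longleftrightarrow>
     (\<forall>t. \<forall>h \<in> set_pmf (history_pmf K t). \<forall>r \<in> set_pmf (K h).
        condition_W_round n h (sampled r) (received r))"

end

theory Submission
  imports Defs
begin

text \<open>
  The exponential potential of the overloaded bins contracts in one step as long as the
  underloads \<open>\<lceil>- y\<rceil>\<close> sum to a constant fraction of \<open>n\<close>. As loads are integers, this can fail only
  while the average load is just below (or at) an integer. Such phases are compensated by adding
  to \<open>y\<close> a small tent function of the position of the total load modulo \<open>n\<close>: it decreases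
  where the drift may vanish, and increases elsewhere at a slope that the drift there absorbs.
  The modified potential contracts by a factor \<open>1 - \<Omega>(1/n)\<close> up to an additive constant in every
  round, so its expectation stays \<open>O(n)\<close>, and Markov's inequality bounds the gap.
\<close>

text \<open>The shift by one makes \<open>tent\<close> decrease also on the step that leaves a multiple of \<open>n\<close>,
  where possibly no bin is underloaded.\<close>

definition phase :: "nat \<Rightarrow> nat \<Rightarrow> nat" where
  "phase n W = (W + n - 1) mod n"

text \<open>The slope \<open>1 / (16 * real n)\<close> per ball is small against
  \<open>1 / real n\<close>, the amount by which each ball raises the average. So a bin that
  receives nothing still loses exponent while the tent rises.\<close>

definition tent :: "nat \<Rightarrow> nat \<Rightarrow> real" where
  "tent n W = min (real (phase n W)) (real n - real (phase n W)) / (16 * real n)"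

text \<open>The number of balls that Condition W allocates when the sampled bin has normalized load
  \<open>y\<close>.\<close>

definition demand :: "real \<Rightarrow> real" where
  "demand y = (if y \<ge> 0 then 1 else of_int (\<lceil>- y\<rceil> + 1))"

text \<open>At rate \<open>1 / 100\<close>, the gain \<open>exp (1 / 100) - 1\<close> from one ball
  exceeds \<open>1 / 100\<close> by about 1/10000, less than the surplus 1/2000 in the shrinking
  that the tent and the underloads supply.\<close>

definition weight :: "nat \<Rightarrow> history \<Rightarrow> nat \<Rightarrow> real" where
  "weight n h i = exp ((normalized_load n h i + tent n (total_load n h)) / 100)"

definition potential :: "nat \<Rightarrow> history \<Rightarrow> real" where
  "potential n h = (\<Sum>i\<in>overloaded_bins n h. weight n h i)"

section \<open>Slopes of the tent function\<close>

lemma phase_less: "n > 0 \<Longrightarrow> phase n W < n"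
  by (simp add: phase_def)

lemma phase_Suc: "n > 0 \<Longrightarrow> phase n (Suc W) = (if Suc (phase n W) = n then 0 else Suc (phase n W))"
proof -
  assume "n > 0"
  then have "Suc W + n - 1 = Suc (W + n - 1)" by simp
  then show ?thesis unfolding phase_def by (simp only: mod_Suc)
qed

lemma tent_nonneg: "n > 0 \<Longrightarrow> tent n W \<ge> 0"
  using phase_less[of n W] by (simp add: tent_def)

lemma tent_le: "n > 0 \<Longrightarrow> tent n W \<le> 1 / 16"
  using phase_less[of n W] by (simp add: tent_def field_simps min_def)

lemma tent_Suc_le:
  assumes "n > 0"
  shows "tent n (Suc W) \<le> tent n W + 1 / (16 * real n)"
proof -
  have "min (real (phase n (Suc W))) (real n - real (phase n (Suc W)))
        \<le> min (real (phase n W)) (real n - real (phase n W)) + 1"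
    using phase_less[OF assms, of W] by (auto simp: phase_Suc[OF assms] min_def)
  then show ?thesis
    using assms by (simp add: tent_def divide_simps)
qed

lemma tent_add_le:
  assumes "n > 0"
  shows "tent n (W + w) \<le> tent n W + real w / (16 * real n)"
proof (induction w)
  case (Suc w)
  then show ?case
    using tent_Suc_le[OF assms, of "W + w"] by (simp add: add_divide_distrib)
qed simp

text \<open>The wrap from phase \<open>n - 1\<close> to 0 is also a descent: the minimum is 1 before
  it and 0 after it.\<close>

lemma tent_descent:
  assumes "real (phase n W) \<ge> real n / 2" "n > 0"
  shows "tent n (Suc W) = tent n W - 1 / (16 * real n)"
proof -
  have "min (real (phase n (Suc W))) (real n - real (phase n (Suc W)))
        = min (real (phase n W)) (real n - real (phase n W)) - 1"
    using phase_less[OF assms(2), of W] assms(1) by (auto simp: phase_Suc[OF assms(2)] min_def)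
  then show ?thesis
    using assms(2) by (simp add: tent_def divide_simps)
qed

section \<open>Normalized loads and the total underload\<close>

lemma load_snoc: "load (h @ [r]) i = load h i + received r i"
  by (simp add: load_def)

lemma total_load_snoc: "total_load n (h @ [r]) = total_load n h + (\<Sum>j\<in>{1..n}. received r j)"
  by (simp add: total_load_def load_snoc sum.distrib)

lemma normalized_load_snoc:
  "normalized_load n (h @ [r]) i =
     normalized_load n h i + real (received r i) - real (\<Sum>j\<in>{1..n}. received r j) / real n"
  unfolding normalized_load_def total_load_snoc load_snoc of_nat_add add_divide_distrib
  by simp

lemma sum_normalized_load: "n > 0 \<Longrightarrow> (\<Sum>i\<in>{1..n}. normalized_load n h i) = 0"
  by (simp add: normalized_load_def sum_subtractf total_load_def)

lemma bins_partition:
  "underloaded_bins n h \<union> overloaded_bins n h = {1..n}"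
  "underloaded_bins n h \<inter> overloaded_bins n h = {}"
  "finite (underloaded_bins n h)" "finite (overloaded_bins n h)"
  by (auto simp: underloaded_bins_def overloaded_bins_def)

lemma mem_overloaded_bins: "i \<in> overloaded_bins n h \<longleftrightarrow> i \<in> {1..n} \<and> normalized_load n h i \<ge> 0"
  by (auto simp: underloaded_bins_def overloaded_bins_def)

lemma sum_bins:
  fixes f :: "nat \<Rightarrow> 'a::comm_monoid_add"
  shows "(\<Sum>i\<in>{1..n}. f i) = (\<Sum>i\<in>underloaded_bins n h. f i) + (\<Sum>i\<in>overloaded_bins n h. f i)"
  using sum.union_disjoint[OF bins_partition(3,4,2)] by (metis bins_partition(1))

text \<open>Loads are integers, so overloaded bins lie well above the average unless the average is
  just below an integer.\<close>

lemma underload_ge: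
  assumes "real (phase n (total_load n h)) < real n / 2" "n \<ge> 2"
  shows "(\<Sum>i\<in>underloaded_bins n h. real_of_int \<lceil>- normalized_load n h i\<rceil>) \<ge> real n / 5"
proof -
  define W where "W = total_load n h"
  define y where "y = normalized_load n h"
  define U where "U = underloaded_bins n h"
  define V where "V = overloaded_bins n h"
  have n0: "n > 0" using assms by simp
  \<comment> \<open>The phase is \<open>W - 1\<close> modulo \<open>n\<close>, here below
    \<open>n - 1\<close>, so adding one recovers \<open>W mod n\<close>. As \<open>f > 0\<close>,
    the average is not an integer, and an overloaded bin has load at least
    \<open>W div n + 1\<close>.\<close>
  define f where "f = phase n W + 1"
  have "2 * real (phase n W) < real n" using assms(1) by (simp add: W_def)
  then have "2 * phase n W < n" by linarith
  have f: "f < n" "2 * f \<le> n + 1" "f > 0"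
    using assms(2) \<open>2 * phase n W < n\<close> by (auto simp: f_def)
  have "(phase n W + 1) mod n = (W + n - 1 + 1) mod n"
    unfolding phase_def by (rule mod_add_left_eq)
  then have "W mod n = f" using n0 f by (simp add: f_def)
  then have W: "real W = real n * real (W div n) + real f"
    by (metis mult_div_mod_eq of_nat_add of_nat_mult)
  have over: "y i \<ge> 1 / 4" if "i \<in> V" for i
  proof -
    have "real (load h i) \<ge> real W / n"
      using that by (simp add: V_def mem_overloaded_bins normalized_load_def W_def)
    then have "real n * real (load h i) \<ge> real n * real (W div n) + real f"
      using n0 W by (simp add: field_simps)
    then have "real n * real (load h i) > real n * real (W div n)"
      using f by linarith
    then have "load h i \<ge> W div n + 1" using n0 by simp
    then have "real (load h i) \<ge> real (W div n) + 1" by linarith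
    \<comment> \<open>From \<open>2 * f \<le> n + 1\<close> and \<open>n \<ge> 2\<close>: (n + 1) /
      (2n) is at most 3/4.\<close>
    moreover have "real f / n \<le> 3/4"
      using f assms(2) n0 by (simp add: field_simps)
    moreover have "real W / n = real (W div n) + real f / n"
      using n0 W by (simp add: field_simps)
    ultimately show ?thesis
      unfolding y_def normalized_load_def W_def by linarith
  qed
  have "real (card V) / 4 \<le> (\<Sum>i\<in>V. y i)"
    using sum_mono[of V "\<lambda>_. 1/4" y] over by simp
  also have "\<dots> = (\<Sum>i\<in>U. - y i)"
    using sum_normalized_load[OF n0, of h] sum_bins[of y n h]
    by (simp add: y_def U_def V_def sum_negf)
  also have "\<dots> \<le> (\<Sum>i\<in>U. of_int \<lceil>- y i\<rceil>)"
    by (intro sum_mono) simp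
  finally have 1: "real (card V) / 4 \<le> (\<Sum>i\<in>U. of_int \<lceil>- y i\<rceil>)" .
  have "real (card U) = (\<Sum>i\<in>U. 1)" by simp
  also have "\<dots> \<le> (\<Sum>i\<in>U. of_int \<lceil>- y i\<rceil>)"
    by (intro sum_mono) (auto simp: U_def underloaded_bins_def y_def)
  finally have 2: "real (card U) \<le> (\<Sum>i\<in>U. of_int \<lceil>- y i\<rceil>)" .
  \<comment> \<open>The underload sum is at least \<open>card U\<close> and at least
    \<open>card V / 4\<close>, so five times it covers all \<open>n\<close> bins.\<close>
  have "real n = real (card U) + real (card V)"
    using sum_bins[of "\<lambda>_. 1::real" n h] by (simp add: U_def V_def)
  with 1 2 show ?thesis unfolding y_def U_def by linarith
qed

section \<open>Balls allocated per round\<close>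

lemma demand_ge_1: "demand y \<ge> 1"
proof -
  have "y < 0 \<Longrightarrow> \<lceil>- y\<rceil> \<ge> 1" by simp
  then show ?thesis unfolding demand_def by auto
qed

lemma demand_antimono: "x \<le> y \<Longrightarrow> demand y \<le> demand x"
proof -
  assume "x \<le> y"
  then have "\<lceil>- y\<rceil> \<le> \<lceil>- x\<rceil>" by (intro ceiling_mono) simp
  then show ?thesis
    using demand_ge_1[of x] \<open>x \<le> y\<close> by (auto simp: demand_def)
qed

text \<open>Capping at \<open>n\<close> keeps the exponents of the drift estimate small. The cap is harmless, as a
  single bin reaching it already contributes enough.\<close>

lemma capped_demand_ge:
  assumes "real (phase n (total_load n h)) < real n / 2" "n \<ge> 2"
  shows "(\<Sum>i\<in>{1..n}. min (demand (normalized_load n h i)) (real n)) \<ge> 6 / 5 * real n"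
proof (cases "\<exists>i\<in>{1..n}. demand (normalized_load n h i) > real n")
  case True
  then obtain i where i: "i \<in> {1..n}" "demand (normalized_load n h i) > real n" by auto
  have "(\<Sum>j\<in>{1..n}-{i}. 1) \<le> (\<Sum>j\<in>{1..n}-{i}. min (demand (normalized_load n h j)) (real n))"
    using assms by (intro sum_mono) (simp add: demand_ge_1)
  then have "real (n - 1) \<le> (\<Sum>j\<in>{1..n}-{i}. min (demand (normalized_load n h j)) (real n))"
    using i by simp
  moreover have "real (n - 1) = real n - 1" using assms by simp
  moreover have "(\<Sum>j\<in>{1..n}. min (demand (normalized_load n h j)) (real n)) =
      real n + (\<Sum>j\<in>{1..n}-{i}. min (demand (normalized_load n h j)) (real n))"
    using i sum.remove[of "{1..n}" i "\<lambda>j. min (demand (normalized_load n h j)) (real n)"] by simp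
  ultimately show ?thesis using assms(2) by simp
next
  case False
  have "(\<Sum>i\<in>{1..n}. min (demand (normalized_load n h i)) (real n)) =
        (\<Sum>i\<in>{1..n}. demand (normalized_load n h i))"
    using False by (intro sum.cong) (auto simp: not_less)
  \<comment> \<open>Every bin demands one ball and an underloaded one
    \<open>\<lceil>- y\<rceil>\<close> more, so the excess over \<open>n\<close> is exactly the
    underload sum.\<close>
  also have "\<dots> = (\<Sum>i\<in>underloaded_bins n h. of_int \<lceil>- normalized_load n h i\<rceil> + 1)
                 + (\<Sum>i\<in>overloaded_bins n h. 1)"
    unfolding sum_bins[of _ n h]
    by (intro arg_cong2[where f="(+)"] sum.cong)
       (auto simp: demand_def underloaded_bins_def mem_overloaded_bins)
  also have "\<dots> = (\<Sum>i\<in>underloaded_bins n h. of_int \<lceil>- normalized_load n h i\<rceil>) + (\<Sum>i\<in>{1..n}. 1)"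
    unfolding sum_bins[of _ n h] sum.distrib by simp
  finally show ?thesis using underload_ge[OF assms] by simp
qed

section \<open>Majorization\<close>

text \<open>Summation by parts, written as an induction. Majorization makes the partial sums of the
  deficit \<open>d\<close> nonnegative, so lowering the common factor from \<open>g k\<close> to
  \<open>g (Suc k)\<close> can only lower their product. At \<open>k = n\<close> the total deficit
  is zero.\<close>

lemma majorized_sum_le:
  fixes q g :: "nat \<Rightarrow> real"
  assumes major: "\<And>k. k \<in> {1..n} \<Longrightarrow> (\<Sum>j\<in>{1..k}. q j) \<le> real k / real n"
    and total: "(\<Sum>j\<in>{1..n}. q j) = 1"
    and anti: "\<And>j k. j \<in> {1..n} \<Longrightarrow> k \<in> {1..n} \<Longrightarrow> j \<le> k \<Longrightarrow> g k \<le> g j"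
    and n: "n > 0"
  shows "(\<Sum>j\<in>{1..n}. q j * g j) \<le> (\<Sum>j\<in>{1..n}. g j) / real n"
proof -
  define d where "d j = 1 / real n - q j" for j
  have sum_d: "(\<Sum>j\<in>{1..k}. d j) = real k / real n - (\<Sum>j\<in>{1..k}. q j)" for k
    by (simp add: d_def sum_subtractf)
  have "k \<in> {1..n} \<Longrightarrow> (\<Sum>j\<in>{1..k}. d j * g j) \<ge> (\<Sum>j\<in>{1..k}. d j) * g k" for k
  proof (induction k)
    case (Suc k)
    show ?case
    proof (cases "k = 0")
      case False
      then have k: "k \<in> {1..n}" using Suc.prems by simp
      have "(\<Sum>j\<in>{1..k}. d j) * g (Suc k) \<le> (\<Sum>j\<in>{1..k}. d j) * g k"
        using anti[OF k Suc.prems] major[OF k] sum_d[of k] by (intro mult_left_mono) auto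
      also have "\<dots> \<le> (\<Sum>j\<in>{1..k}. d j * g j)" using Suc.IH k by simp
      finally show ?thesis by (simp add: algebra_simps)
    qed simp
  qed simp
  then have "(\<Sum>j\<in>{1..n}. d j * g j) \<ge> (\<Sum>j\<in>{1..n}. d j) * g n" using n by simp
  then have "(\<Sum>j\<in>{1..n}. d j * g j) \<ge> 0"
    using n total sum_d[of n] by simp
  then show ?thesis
    by (simp add: d_def left_diff_distrib sum_subtractf sum_divide_distrib)
qed

text \<open>Sorting by \<open>\<sigma>\<close> reduces this to \<open>majorized_sum_le\<close>, and
  summing over all bins removes \<open>\<sigma>\<close> again. It serves twice: with the weights of
  overloaded bins, and with the negated capped demand, where it gives a lower bound on the expected
  demand.\<close>

lemma condition_P_sum_le:
  assumes P: "condition_P n K" and h: "h \<in> set_pmf (history_pmf K t)" and n: "n > 0"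
    and "mono \<phi>"
  shows "(\<Sum>s\<in>{1..n}. pmf (sampling_pmf K h) s * \<phi> (normalized_load n h s))
         \<le> (\<Sum>s\<in>{1..n}. \<phi> (normalized_load n h s)) / real n"
proof -
  let ?p = "sampling_pmf K h"
  from P h have supp: "set_pmf ?p \<subseteq> {1..n}"
    unfolding condition_P_def by blast
  have "\<exists>\<sigma>. bij_betw \<sigma> {1..n} {1..n} \<and>
      (\<forall>j\<in>{1..n}. \<forall>k\<in>{1..n}. j \<le> k \<longrightarrow>
        normalized_load n h (\<sigma> j) \<ge> normalized_load n h (\<sigma> k)) \<and>
      (\<forall>k\<in>{1..n}. (\<Sum>j\<in>{1..k}. pmf ?p (\<sigma> j)) \<le> real k / real n)"
    using P h unfolding condition_P_def by blast
  then obtain \<sigma> where bij: "bij_betw \<sigma> {1..n} {1..n}"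
    and sorted: "\<And>j k. j \<in> {1..n} \<Longrightarrow> k \<in> {1..n} \<Longrightarrow> j \<le> k \<Longrightarrow>
      normalized_load n h (\<sigma> k) \<le> normalized_load n h (\<sigma> j)"
    and major: "\<And>k. k \<in> {1..n} \<Longrightarrow> (\<Sum>j\<in>{1..k}. pmf ?p (\<sigma> j)) \<le> real k / real n"
    by blast
  have re: "(\<Sum>j\<in>{1..n}. f (\<sigma> j)) = (\<Sum>j\<in>{1..n}. f j)" for f :: "nat \<Rightarrow> real"
    by (rule sum.reindex_bij_betw[OF bij])
  have "(\<Sum>j\<in>{1..n}. pmf ?p (\<sigma> j)) = 1"
    unfolding re[of "pmf ?p"] using supp by (intro sum_pmf_eq_1) auto
  then have "(\<Sum>j\<in>{1..n}. pmf ?p (\<sigma> j) * \<phi> (normalized_load n h (\<sigma> j)))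
      \<le> (\<Sum>j\<in>{1..n}. \<phi> (normalized_load n h (\<sigma> j))) / real n"
    using major n by (intro majorized_sum_le) (auto intro!: monoD[OF \<open>mono \<phi>\<close>] sorted)
  then show ?thesis
    using re[of "\<lambda>s. pmf ?p s * \<phi> (normalized_load n h s)"]
      re[of "\<lambda>s. \<phi> (normalized_load n h s)"] by simp
qed

section \<open>Change of the potential in one round\<close>

text \<open>Separates the growth from the bin's own balls from a factor common to all bins, which
  comes from the rising average and the tent.\<close>

lemma weight_snoc:
  assumes "n > 0"
  defines "w \<equiv> \<lambda>r. (\<Sum>j\<in>{1..n}. received r j)"
  shows "weight n (h @ [r]) i = weight n h i * exp (real (received r i) / 100) *
    exp (- (real (w r) / n - tent n (total_load n h + w r) + tent n (total_load n h)) / 100)"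
  unfolding weight_def normalized_load_snoc total_load_snoc w_def
  by (simp add: exp_add[symmetric] field_simps)

lemma condition_W_round_total:
  assumes "condition_W_round n h i a" "i \<in> {1..n}"
  shows "real (\<Sum>j\<in>{1..n}. a j) = demand (normalized_load n h i)"
proof (cases "normalized_load n h i \<ge> 0")
  case True
  then have "(\<Sum>j\<in>{1..n}. a j) = (\<Sum>j\<in>{1..n}. if j = i then 1 else 0)"
    using assms(1) by (intro sum.cong) (auto simp: condition_W_round_def)
  then show ?thesis using assms(2) True by (simp add: demand_def)
next
  case False
  then have "int (\<Sum>j\<in>underloaded_bins n h. a j) = \<lceil>- normalized_load n h i\<rceil> + 1"
    "\<forall>j\<in>overloaded_bins n h. a j = 0"
    using assms(1) by (auto simp: condition_W_round_def Let_def)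
  then have "int (\<Sum>j\<in>{1..n}. a j) = \<lceil>- normalized_load n h i\<rceil> + 1"
    unfolding sum_bins[of _ n h] by simp
  then have "real (\<Sum>j\<in>{1..n}. a j) = of_int (\<lceil>- normalized_load n h i\<rceil> + 1)"
    by (metis of_int_of_nat_eq)
  then show ?thesis using False by (simp add: demand_def)
qed

text \<open>The average does not fall, so a bin leaves the underloaded set only by receiving at
  least \<open>\<lceil>- y\<rceil>\<close> balls. Condition W lets at most two bins do so, and each
  gets at most \<open>\<lceil>- y\<rceil> + 1 < - y + 2\<close>.\<close>

lemma newcomers_bound:
  assumes W: "condition_W_round n h (sampled r) (received r)" and n: "n > 0"
  defines "N \<equiv> underloaded_bins n h \<inter> overloaded_bins n (h @ [r])"
  shows "card N \<le> 2" "\<And>j. j \<in> N \<Longrightarrow> normalized_load n (h @ [r]) j \<le> 2"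
proof -
  let ?y = "normalized_load n h" and ?B = "underloaded_bins n h" and ?a = "received r"
  have y': "normalized_load n (h @ [r]) j \<le> ?y j + real (?a j)" for j
    unfolding normalized_load_snoc by (simp del: of_nat_sum)
  let ?B1 = "{j \<in> ?B. int (?a j) = \<lceil>- ?y j\<rceil> + 1}" and ?B2 = "{j \<in> ?B. int (?a j) = \<lceil>- ?y j\<rceil>}"
  have "card N \<le> 2 \<and> (\<forall>j\<in>N. normalized_load n (h @ [r]) j \<le> 2)"
  proof (cases "?y (sampled r) \<ge> 0")
    case True
    have "?a j = 0" if "j \<in> ?B" for j
      using that True W by (auto simp: condition_W_round_def underloaded_bins_def)
    then have "normalized_load n (h @ [r]) j < 0" if "j \<in> ?B" for j
      using y'[of j] that by (simp add: underloaded_bins_def)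
    then have "N = {}"
      unfolding N_def by (force simp: mem_overloaded_bins)
    then show ?thesis by simp
  next
    case False
    then have c: "card ?B1 \<le> 1" "card ?B2 \<le> 1"
      and cases: "\<And>j. j \<in> ?B \<Longrightarrow> int (?a j) = \<lceil>- ?y j\<rceil> + 1 \<or> int (?a j) = \<lceil>- ?y j\<rceil> \<or> int (?a j) \<le> \<lceil>- ?y j\<rceil> - 1"
      using W by (auto simp: condition_W_round_def Let_def)
    have sub: "N \<subseteq> ?B1 \<union> ?B2"
    proof
      fix j assume j: "j \<in> N"
      then have "?y j + real (?a j) \<ge> 0"
        using y'[of j] by (simp add: N_def mem_overloaded_bins)
      then have "\<not> int (?a j) \<le> \<lceil>- ?y j\<rceil> - 1" by linarith
      then show "j \<in> ?B1 \<union> ?B2" using j cases[of j] by (auto simp: N_def)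
    qed
    have "finite (?B1 \<union> ?B2)" using bins_partition(3)[of n h] by simp
    then have "card N \<le> card (?B1 \<union> ?B2)" using sub by (rule card_mono)
    also have "\<dots> \<le> card ?B1 + card ?B2" by (rule card_Un_le)
    finally have "card N \<le> 2" using c by simp
    moreover have "normalized_load n (h @ [r]) j \<le> 2" if "j \<in> N" for j
    proof -
      have "int (?a j) \<le> \<lceil>- ?y j\<rceil> + 1" using that sub by auto
      then have "?y j + real (?a j) \<le> 2" by linarith
      then show ?thesis using y'[of j] by linarith
    qed
    ultimately show ?thesis by simp
  qed
  then show "card N \<le> 2" "\<And>j. j \<in> N \<Longrightarrow> normalized_load n (h @ [r]) j \<le> 2" by auto
qed

lemma weight_pos: "weight n h i > 0"
  by (simp add: weight_def)

lemma potential_nonneg: "potential n h \<ge> 0"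
  unfolding potential_def by (intro sum_nonneg) (simp add: weight_pos less_imp_le)

lemma weight_le_3:
  assumes "normalized_load n h i \<le> 2" "n > 0"
  shows "weight n h i \<le> 3"
proof -
  have "weight n h i \<le> exp 1"
    unfolding weight_def using assms tent_le[of n "total_load n h"] by simp
  also have "\<dots> \<le> 3" by (rule exp_le)
  finally show ?thesis .
qed

text \<open>Three contributions: overloaded bins shrink by the common factor \<open>G\<close>, a
  sampled overloaded bin gains one ball, and at most two newcomers of weight at most 3
  enter.\<close>

lemma potential_snoc_le:
  assumes W: "condition_W_round n h (sampled r) (received r)" and n: "n > 0"
    and s: "sampled r \<in> {1..n}"
    and G: "G = exp (- (real w / n - tent n (total_load n h + w) + tent n (total_load n h)) / 100)"
    and w: "w = (\<Sum>j\<in>{1..n}. received r j)"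
  shows "potential n (h @ [r]) \<le> potential n h * G +
    (exp (1 / 100) - 1) * (if normalized_load n h (sampled r) \<ge> 0 then weight n h (sampled r) else 0) + 6"
proof -
  let ?U = "underloaded_bins n h" and ?V = "overloaded_bins n h" and ?V' = "overloaded_bins n (h @ [r])"
  let ?s = "sampled r"
  let ?e = "exp (1 / 100) - 1 :: real"
  \<comment> \<open>The tent rises by at most a sixteenth of what \<open>w\<close> balls add to the
    average.\<close>
  have "real w / n - tent n (total_load n h + w) + tent n (total_load n h) \<ge> 0"
    using tent_add_le[OF n, of "total_load n h" w] n by (simp add: field_simps)
  then have G1: "G \<le> 1" "G > 0" unfolding G by simp_all
  have nonneg: "weight n h' i \<ge> 0" for h' i by (simp add: weight_pos less_imp_le)
  have e: "?e \<ge> 0" by simp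
  have old: "weight n (h @ [r]) i \<le> weight n h i * G + (if i = ?s then ?e * weight n h i else 0)"
    if i: "i \<in> ?V" for i
  proof -
    have eq: "weight n (h @ [r]) i = weight n h i * G * exp (real (received r i) / 100)"
      using weight_snoc[OF n, of h r i] by (simp add: G w)
    show ?thesis
    proof (cases "i = ?s")
      case True
      then have "received r i = 1"
        using W i by (auto simp: condition_W_round_def mem_overloaded_bins)
      then have "weight n (h @ [r]) i = weight n h i * G + ?e * weight n h i * G"
        unfolding eq by (simp add: algebra_simps)
      \<comment> \<open>Dropping \<open>G\<close> from the gain decouples it from the shrinking, so
        that the two can be averaged separately.\<close>
      also have "?e * weight n h i * G \<le> ?e * weight n h i * 1"
        using G1 nonneg e by (intro mult_left_mono mult_nonneg_nonneg) auto
      finally show ?thesis using True by simp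
    next
      case False
      then have "received r i = 0"
        using W i by (cases "normalized_load n h ?s \<ge> 0")
          (auto simp: condition_W_round_def mem_overloaded_bins Let_def)
      then show ?thesis unfolding eq using False by simp
    qed
  qed
  have "?V' = (?U \<inter> ?V') \<union> (?V \<inter> ?V')"
    using bins_partition(1)[of n h] bins_partition(1)[of n "h @ [r]"] by blast
  then have "potential n (h @ [r]) = (\<Sum>i\<in>(?U \<inter> ?V') \<union> (?V \<inter> ?V'). weight n (h @ [r]) i)"
    unfolding potential_def by simp
  also have "\<dots> = (\<Sum>i\<in>?U \<inter> ?V'. weight n (h @ [r]) i) + (\<Sum>i\<in>?V \<inter> ?V'. weight n (h @ [r]) i)"
    using bins_partition[of n h] by (intro sum.union_disjoint) auto
  also have "(\<Sum>i\<in>?U \<inter> ?V'. weight n (h @ [r]) i) \<le> of_nat (card (?U \<inter> ?V')) * 3"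
    using newcomers_bound(2)[OF W n] n by (intro sum_bounded_above weight_le_3)
  also have "\<dots> \<le> 6"
    using newcomers_bound(1)[OF W n] by simp
  \<comment> \<open>Bins that have just become underloaded are kept in the sum; their weights are
    nonnegative.\<close>
  also have "(\<Sum>i\<in>?V \<inter> ?V'. weight n (h @ [r]) i) \<le> (\<Sum>i\<in>?V. weight n (h @ [r]) i)"
    using bins_partition(4) nonneg by (intro sum_mono2) auto
  also have "\<dots> \<le> (\<Sum>i\<in>?V. weight n h i * G + (if i = ?s then ?e * weight n h i else 0))"
    by (intro sum_mono old)
  also have "\<dots> = potential n h * G + (if ?s \<in> ?V then ?e * weight n h ?s else 0)"
    unfolding sum.distrib potential_def sum_distrib_right
    using bins_partition(4)[of n h] by simp
  also have "(if ?s \<in> ?V then ?e * weight n h ?s else 0) =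
      ?e * (if normalized_load n h ?s \<ge> 0 then weight n h ?s else 0)"
    using s by (simp add: mem_overloaded_bins)
  finally show ?thesis by simp
qed

section \<open>Expected drift\<close>

text \<open>The product (1 - 99z/100)(1 + z) equals 1 + z/100 - 99z^2/100, which is at least 1
  precisely because \<open>z \<le> 1 / 99\<close>; then \<open>1 + z \<le> exp z\<close>.\<close>

lemma exp_neg_le:
  assumes "0 \<le> (z::real)" "z \<le> 1 / 99"
  shows "exp (- z) \<le> 1 - 99 / 100 * z"
proof -
  have "(1 - 99 / 100 * z) * (1 + z) \<ge> 1"
    using mult_left_mono[OF assms(2,1)] by (simp add: algebra_simps)
  moreover have "1 + z \<le> exp z" by (rule exp_ge_add_one_self)
  then have "(1 - 99 / 100 * z) * (1 + z) \<le> (1 - 99 / 100 * z) * exp z"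
    using assms by (intro mult_left_mono) auto
  ultimately have "1 \<le> (1 - 99 / 100 * z) * exp z"
    by linarith
  then show ?thesis by (simp add: exp_minus field_simps)
qed

text \<open>\<open>\<gamma>\<close> bounds the factor by which all old weights shrink when bin \<open>s\<close> is sampled.\<close>

lemma shrink_factor_average:
  assumes alloc: "allocation_process n K" and P: "condition_P n K" and W: "condition_W n K"
    and h: "h \<in> set_pmf (history_pmf K t)" and n: "n \<ge> 2"
  defines "T \<equiv> total_load n h"
  obtains \<gamma> where
    "\<And>r. r \<in> set_pmf (K h) \<Longrightarrow> exp (- (real (\<Sum>j\<in>{1..n}. received r j) / n
        - tent n (T + (\<Sum>j\<in>{1..n}. received r j)) + tent n T) / 100) \<le> \<gamma> (sampled r)"
    "(\<Sum>s\<in>{1..n}. pmf (sampling_pmf K h) s * \<gamma> s) \<le> 1 - 21 / (2000 * real n)"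
proof -
  let ?p = "sampling_pmf K h" and ?w = "\<lambda>r. (\<Sum>j\<in>{1..n}. received r j)"
  let ?y = "normalized_load n h"
  have n0: "n > 0" using n by simp
  have supp: "set_pmf ?p \<subseteq> {1..n}" using P h unfolding condition_P_def by blast
  have mass: "(\<Sum>s\<in>{1..n}. pmf ?p s) = 1"
    using supp by (intro sum_pmf_eq_1) auto
  show ?thesis
  proof (cases "real (phase n T) \<ge> real n / 2")
    case True
    have "exp (- (real (?w r) / n - tent n (T + ?w r) + tent n T) / 100) \<le> 1 - 21 / (2000 * real n)"
      if r: "r \<in> set_pmf (K h)" for r
    proof -
      have "?w r \<ge> 1" using alloc h r unfolding allocation_process_def by blast
      \<comment> \<open>The first ball is split off: on the descending half it surely lowers the
        tent, for a total of 1/n + 1/(16n). The other \<open>v\<close> balls may move the tent up,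
        but by less than they raise the average.\<close>
      then obtain v where v: "?w r = Suc v" by (metis Suc_le_D One_nat_def)
      have "tent n (Suc T + v) \<le> tent n (Suc T) + real v / (16 * real n)"
        by (rule tent_add_le[OF n0])
      moreover have "tent n (Suc T) = tent n T - 1 / (16 * real n)"
        using True n0 by (rule tent_descent)
      moreover have "real v / (16 * real n) \<le> real v / real n"
        using n0 by (intro divide_left_mono) auto
      moreover have "real (Suc v) / n = 1 / n + v / n" by (simp add: add_divide_distrib)
      ultimately have "17 / (16 * real n) \<le> real (?w r) / n - tent n (T + ?w r) + tent n T"
        unfolding v by simp
      then have "exp (- (real (?w r) / n - tent n (T + ?w r) + tent n T) / 100)
          \<le> exp (- (17 / (1600 * real n)))"
        by simp
      also have "\<dots> \<le> 1 - 99 / 100 * (17 / (1600 * real n))"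
        using n by (intro exp_neg_le) (simp_all add: field_simps)
      also have "\<dots> \<le> 1 - 21 / (2000 * real n)"
        using n0 by (simp add: field_simps)
      finally show ?thesis .
    qed
    moreover have "(\<Sum>s\<in>{1..n}. pmf ?p s * (1 - 21 / (2000 * real n))) \<le> 1 - 21 / (2000 * real n)"
      by (simp only: mass mult_1_left order_refl flip: sum_distrib_right)
    ultimately show ?thesis by (rule that)
  next
    case False
    \<comment> \<open>The constant is 99/100 * 15/1600: a ball raises the average by 1/n and the
      tent takes back at most a sixteenth of this. The cap at \<open>n\<close> keeps the exponent
      below the bound \<open>1 / 99\<close> of \<open>exp_neg_le\<close>.\<close>
    define \<gamma> where "\<gamma> s = 1 - 297 / 32000 * min (demand (?y s)) (real n) / real n" for s
    have "exp (- (real (?w r) / n - tent n (T + ?w r) + tent n T) / 100) \<le> \<gamma> (sampled r)"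
      if r: "r \<in> set_pmf (K h)" for r
    proof -
      let ?m = "min (demand (?y (sampled r))) (real n)"
      have "sampled r \<in> {1..n}" using r supp by (auto simp: sampling_pmf_def)
      then have w: "real (?w r) = demand (?y (sampled r))"
        using W h r by (intro condition_W_round_total) (auto simp: condition_W_def)
      have "15 / 16 * (?m / n) \<le> 15 / 16 * (real (?w r) / n)"
        using n0 w by (intro mult_left_mono divide_right_mono) auto
      also have "\<dots> \<le> real (?w r) / n - tent n (T + ?w r) + tent n T"
        using tent_add_le[OF n0, of T "?w r"] by simp
      finally have "exp (- (real (?w r) / n - tent n (T + ?w r) + tent n T) / 100)
          \<le> exp (- (15 / 1600 * (?m / n)))" by simp
      also have "\<dots> \<le> 1 - 99 / 100 * (15 / 1600 * (?m / n))"
      proof (rule exp_neg_le)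
        have "0 \<le> ?m / n" "?m / n \<le> 1" using n0 demand_ge_1[of "?y (sampled r)"] by auto
        then show "0 \<le> 15 / 1600 * (?m / n)" "15 / 1600 * (?m / n) \<le> 1 / 99" by linarith+
      qed
      finally show ?thesis by (simp add: \<gamma>_def)
    qed
    moreover have "(\<Sum>s\<in>{1..n}. pmf ?p s * \<gamma> s) \<le> 1 - 21 / (2000 * real n)"
    proof -
      \<comment> \<open>Demand falls as load grows, so the bias towards light bins makes its mean at
        least the uniform one.\<close>
      have "mono (\<lambda>y. - min (demand y) (real n))"
        by (intro monoI) (use demand_antimono in \<open>auto simp: min_def intro: order_trans\<close>)
      from condition_P_sum_le[OF P h n0 this]
      have "(\<Sum>s\<in>{1..n}. pmf ?p s * min (demand (?y s)) (real n))
          \<ge> (\<Sum>s\<in>{1..n}. min (demand (?y s)) (real n)) / n"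
        by (simp add: sum_negf)
      moreover have "(\<Sum>s\<in>{1..n}. min (demand (?y s)) (real n)) / n \<ge> 6 / 5"
        using capped_demand_ge[of n h] False n by (simp add: T_def field_simps)
      ultimately have ge: "(\<Sum>s\<in>{1..n}. pmf ?p s * min (demand (?y s)) (real n)) \<ge> 6 / 5" by linarith
      have "(\<Sum>s\<in>{1..n}. pmf ?p s * \<gamma> s) =
          (\<Sum>s\<in>{1..n}. pmf ?p s - 297 / 32000 / n * (pmf ?p s * min (demand (?y s)) (real n)))"
        by (intro sum.cong) (auto simp: \<gamma>_def field_simps)
      also have "\<dots> = 1 - 297 / 32000 / n * (\<Sum>s\<in>{1..n}. pmf ?p s * min (demand (?y s)) (real n))"
        by (simp only: sum_subtractf mass flip: sum_distrib_left)
      also have "\<dots> \<le> 1 - 297 / 32000 / n * (6 / 5)"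
        using ge n0 by (intro diff_left_mono mult_left_mono) auto
      also have "\<dots> \<le> 1 - 21 / (2000 * real n)" using n0 by (simp add: field_simps)
      finally show ?thesis .
    qed
    ultimately show ?thesis by (rule that)
  qed
qed

text \<open>Shrinking contributes -21/2000 and the sampled bin's ball at most 101/10000, both times
  potential over \<open>n\<close>; the difference is the rate 1/2500.\<close>

lemma potential_drift:
  assumes alloc: "allocation_process n K" and P: "condition_P n K" and W: "condition_W n K"
    and h: "h \<in> set_pmf (history_pmf K t)" and n: "n \<ge> 2"
  shows "(\<integral>\<^sup>+r. ennreal (potential n (h @ [r])) \<partial>measure_pmf (K h))
         \<le> ennreal ((1 - 1 / (2500 * real n)) * potential n h + 6)"
proof -
  let ?p = "sampling_pmf K h" and ?w = "\<lambda>r. (\<Sum>j\<in>{1..n}. received r j)"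
  let ?y = "normalized_load n h" and ?e = "exp (1 / 100) - 1 :: real"
  let ?A = "\<lambda>s. if ?y s \<ge> 0 then weight n h s else 0"
  have n0: "n > 0" using n by simp
  have supp: "set_pmf ?p \<subseteq> {1..n}" using P h unfolding condition_P_def by blast
  have fin: "finite (set_pmf ?p)" using supp finite_subset by blast
  have mass: "(\<Sum>s\<in>{1..n}. pmf ?p s) = 1"
    using supp by (intro sum_pmf_eq_1) auto
  obtain \<gamma> where \<gamma>: "\<And>r. r \<in> set_pmf (K h) \<Longrightarrow> exp (- (real (?w r) / n
        - tent n (total_load n h + ?w r) + tent n (total_load n h)) / 100) \<le> \<gamma> (sampled r)"
    and avg: "(\<Sum>s\<in>{1..n}. pmf ?p s * \<gamma> s) \<le> 1 - 21 / (2000 * real n)"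
    using shrink_factor_average[OF alloc P W h n] by blast
  \<comment> \<open>A bound that depends on the sampled bin alone turns the expectation into a
    finite sum, whatever the law of the allocation and the internal choices.\<close>
  define F where "F s = potential n h * \<gamma> s + ?e * ?A s + 6" for s
  have F: "potential n (h @ [r]) \<le> F (sampled r)" if r: "r \<in> set_pmf (K h)" for r
  proof -
    have "sampled r \<in> {1..n}" using r supp by (auto simp: sampling_pmf_def)
    moreover have "condition_W_round n h (sampled r) (received r)"
      using W h r by (auto simp: condition_W_def)
    ultimately have "potential n (h @ [r]) \<le> potential n h * exp (- (real (?w r) / n
        - tent n (total_load n h + ?w r) + tent n (total_load n h)) / 100)
        + ?e * ?A (sampled r) + 6"
      using n0 by (intro potential_snoc_le) auto
    also have "\<dots> \<le> F (sampled r)"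
      unfolding F_def by (intro add_right_mono mult_left_mono \<gamma>[OF r] potential_nonneg)
    finally show ?thesis .
  qed
  have "(\<integral>\<^sup>+r. ennreal (potential n (h @ [r])) \<partial>measure_pmf (K h))
      \<le> (\<integral>\<^sup>+r. ennreal (F (sampled r)) \<partial>measure_pmf (K h))"
    by (intro nn_integral_mono_AE) (auto simp: AE_measure_pmf_iff intro!: ennreal_leI F)
  also have "\<dots> = (\<integral>\<^sup>+s. ennreal (F s) \<partial>measure_pmf ?p)"
    by (simp add: sampling_pmf_def)
  also have "\<dots> = ennreal (\<integral>s. F s \<partial>measure_pmf ?p)"
  proof (rule nn_integral_eq_integral)
    show "integrable (measure_pmf ?p) F"
      by (rule integrable_measure_pmf_finite[OF fin])
    have "F s \<ge> 0" if "s \<in> set_pmf ?p" for s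
    proof -
      from that obtain r where "r \<in> set_pmf (K h)" "s = sampled r"
        by (auto simp: sampling_pmf_def)
      then show ?thesis using F[of r] potential_nonneg[of n "h @ [r]"] by simp
    qed
    then show "AE s in measure_pmf ?p. 0 \<le> F s" by (simp add: AE_measure_pmf_iff)
  qed
  also have "(\<integral>s. F s \<partial>measure_pmf ?p) = (\<Sum>s\<in>{1..n}. F s * pmf ?p s)"
    using supp by (intro integral_measure_pmf_real) auto
  also have "\<dots> = (\<Sum>s\<in>{1..n}. potential n h * (pmf ?p s * \<gamma> s) + ?e * (pmf ?p s * ?A s) + 6 * pmf ?p s)"
    by (intro sum.cong) (simp_all add: F_def algebra_simps)
  also have "\<dots> = potential n h * (\<Sum>s\<in>{1..n}. pmf ?p s * \<gamma> s)
      + ?e * (\<Sum>s\<in>{1..n}. pmf ?p s * ?A s) + 6"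
    by (simp only: sum.distrib mass mult_1_right flip: sum_distrib_left)
  also have "\<dots> \<le> potential n h * (1 - 21 / (2000 * real n)) + 101 / 10000 * (potential n h / n) + 6"
  proof (intro add_right_mono add_mono mult_left_mono avg potential_nonneg mult_mono)
    show "?e \<le> 101 / 10000" using exp_bound[of "1/100"] by (simp add: power2_eq_square)
    \<comment> \<open>Extending the weight by 0 to negative loads keeps it monotone; the tent is a
      constant once the history is fixed.\<close>
    define \<phi> where "\<phi> y = (if y \<ge> 0 then exp ((y + tent n (total_load n h)) / 100) else 0)" for y :: real
    have "mono \<phi>" by (intro monoI) (auto simp: \<phi>_def)
    from condition_P_sum_le[OF P h n0 this]
    have "(\<Sum>s\<in>{1..n}. pmf ?p s * ?A s) \<le> (\<Sum>s\<in>{1..n}. ?A s) / n"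
      by (simp add: \<phi>_def weight_def cong: if_cong)
    also have "(\<Sum>s\<in>{1..n}. ?A s) = potential n h"
      unfolding potential_def sum_bins[of ?A n h]
      by (simp add: underloaded_bins_def mem_overloaded_bins sum.neutral)
    finally show "(\<Sum>s\<in>{1..n}. pmf ?p s * ?A s) \<le> potential n h / n" .
    show "0 \<le> (\<Sum>s\<in>{1..n}. pmf ?p s * ?A s)"
      by (intro sum_nonneg mult_nonneg_nonneg) (auto simp: weight_pos less_imp_le)
  qed simp
  also have "\<dots> = (1 - 1 / (2500 * real n)) * potential n h + 6"
    using n0 by (simp add: field_simps)
  finally show ?thesis using ennreal_leI by simp
qed

section \<open>Expectation of the potential and tail of the gap\<close>

text \<open>The bound is the fixed point 6 * 2500n of the drift recursion, and the start, at most
  \<open>3 * n\<close>, lies below it.\<close>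

lemma potential_expectation:
  assumes "allocation_process n K" "condition_P n K" "condition_W n K" "n \<ge> 2"
  shows "(\<integral>\<^sup>+h. ennreal (potential n h) \<partial>measure_pmf (history_pmf K t)) \<le> ennreal (15000 * real n)"
proof (induction t)
  case 0
  have "weight n [] i \<le> 3" for i
    using assms by (intro weight_le_3) (auto simp: normalized_load_def total_load_def load_def)
  then have "potential n [] \<le> of_nat (card (overloaded_bins n [])) * 3"
    unfolding potential_def by (intro sum_bounded_above) auto
  also have "card (overloaded_bins n []) \<le> n"
    using card_mono[of "{1..n}" "overloaded_bins n []"] by (auto simp: overloaded_bins_def)
  finally show ?case by (auto intro!: ennreal_leI)
next
  case (Suc t)
  let ?M = "measure_pmf (history_pmf K t)" and ?c = "1 - 1 / (2500 * real n)"
  have c: "?c \<ge> 0" using assms(4) by simp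
  have "(\<integral>\<^sup>+h. ennreal (potential n h) \<partial>measure_pmf (history_pmf K (Suc t)))
      = (\<integral>\<^sup>+h. (\<integral>\<^sup>+r. ennreal (potential n (h @ [r])) \<partial>measure_pmf (K h)) \<partial>?M)"
    by simp
  also have "\<dots> \<le> (\<integral>\<^sup>+h. ennreal (?c * potential n h + 6) \<partial>?M)"
    using potential_drift[OF assms(1-3) _ assms(4)]
    by (intro nn_integral_mono_AE) (auto simp: AE_measure_pmf_iff)
  also have "\<dots> = (\<integral>\<^sup>+h. ennreal ?c * ennreal (potential n h) + 6 \<partial>?M)"
    using c potential_nonneg by (simp add: ennreal_plus ennreal_mult)
  also have "\<dots> = ennreal ?c * (\<integral>\<^sup>+h. ennreal (potential n h) \<partial>?M) + 6"
    by (simp add: nn_integral_add nn_integral_cmult measure_pmf.emeasure_space_1)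
  also have "\<dots> \<le> ennreal ?c * ennreal (15000 * real n) + 6"
    using Suc by (intro add_right_mono mult_left_mono) auto
  also have "\<dots> = ennreal (?c * (15000 * real n) + 6)"
    using c by (simp add: ennreal_plus ennreal_mult)
  also have "?c * (15000 * real n) + 6 = 15000 * real n"
    using assms(4) by (simp add: field_simps)
  finally show ?case .
qed

text \<open>A fullest bin alone suffices: \<open>g \<ge> 0\<close> makes it overloaded, and the
  nonnegative tent only adds to its weight.\<close>

lemma gap_le_potential:
  assumes "gap n h > g" "g \<ge> 0" "n > 0"
  shows "potential n h \<ge> exp (g / 100)"
proof -
  have "Max (load h ` {1..n}) \<in> load h ` {1..n}"
    using assms(3) by (intro Max_in) auto
  then obtain i where i: "i \<in> {1..n}" "Max (load h ` {1..n}) = load h i" by auto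
  then have y: "normalized_load n h i > g"
    using assms(1) by (simp add: gap_def normalized_load_def)
  have "exp (g / 100) \<le> weight n h i"
    unfolding weight_def using y tent_nonneg[OF assms(3), of "total_load n h"] by simp
  also have "\<dots> \<le> potential n h"
    unfolding potential_def using i y assms(2) bins_partition(4)
    by (intro member_le_sum) (auto simp: mem_overloaded_bins weight_pos less_imp_le)
  finally show ?thesis .
qed

lemma gap_tail:
  assumes "allocation_process n K" "condition_P n K" "condition_W n K" "n \<ge> 15000"
  shows "measure_pmf.prob (history_pmf K m) {h. gap n h \<le> 400 * ln (real n)} \<ge> 1 - 1 / real n ^ 2"
proof -
  let ?M = "measure_pmf (history_pmf K m)"
  let ?bad = "{h. gap n h > 400 * ln (real n)}"
  have n0: "n > 0" "real n \<ge> 15000" using assms(4) by auto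
  \<comment> \<open>The factor 400 is four times the inverse rate 100. Markov's inequality then
    gives 15000n / n^4, and \<open>n \<ge> 15000\<close> absorbs the constant into one factor
    \<open>n\<close>, leaving n^(-2).\<close>
  have "exp (400 * ln (real n) / 100) = real n ^ 4"
    using n0 exp_of_nat_mult[of 4 "ln (real n)"] by simp
  then have large: "potential n h \<ge> real n ^ 4" if "h \<in> ?bad" for h
    using that gap_le_potential[of "400 * ln (real n)" n h] n0 by simp
  have "ennreal (real n ^ 4) * emeasure ?M ?bad = (\<integral>\<^sup>+h. ennreal (real n ^ 4) * indicator ?bad h \<partial>?M)"
    by (simp add: nn_integral_cmult)
  also have "\<dots> \<le> (\<integral>\<^sup>+h. ennreal (potential n h) \<partial>?M)"
    by (intro nn_integral_mono) (auto simp: indicator_def intro!: ennreal_leI large)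
  also have "\<dots> \<le> ennreal (15000 * real n)"
    using assms by (intro potential_expectation) auto
  finally have "real n ^ 4 * measure ?M ?bad \<le> 15000 * real n"
    by (simp add: measure_pmf.emeasure_eq_measure flip: ennreal_mult)
  also have "\<dots> \<le> real n * real n" using n0 by (intro mult_right_mono) auto
  finally have "real n ^ 2 * (real n ^ 2 * measure ?M ?bad) \<le> real n ^ 2 * 1"
    by (simp add: power2_eq_square power4_eq_xxxx mult.assoc)
  then have "real n ^ 2 * measure ?M ?bad \<le> 1"
    using n0 by (simp only: mult_le_cancel_left_pos zero_less_power of_nat_0_less_iff)
  then have "measure ?M ?bad \<le> 1 / real n ^ 2"
    using n0 by (simp add: field_simps)
  moreover have "measure ?M {h. gap n h \<le> 400 * ln (real n)} = 1 - measure ?M ?bad"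
  proof -
    have "{h. gap n h \<le> 400 * ln (real n)} = space ?M - ?bad" by auto
    then show ?thesis using measure_pmf.prob_compl[of ?bad "history_pmf K m"] by simp
  qed
  ultimately show ?thesis by simp
qed

theorem theorem3p1:
  "\<exists>C::real. C > 0 \<and>
     (\<forall>\<^sub>F n in sequentially.
        \<forall>K :: history \<Rightarrow> outcome pmf.
          allocation_process n K \<longrightarrow> condition_P n K \<longrightarrow> condition_W n K \<longrightarrow>
          (\<forall>m\<ge>1. measure_pmf.prob (history_pmf K m) {h. gap n h \<le> C * ln (real n)}
                    \<ge> 1 - 1 / real n ^ 2))"
proof (intro exI[of _ 400] conjI)
  show "\<forall>\<^sub>F n in sequentially.
      \<forall>K :: history \<Rightarrow> outcome pmf.
        allocation_process n K \<longrightarrow> condition_P n K \<longrightarrow> condition_W n K \<longrightarrow>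
        (\<forall>m\<ge>1. measure_pmf.prob (history_pmf K m) {h. gap n h \<le> 400 * ln (real n)}
                  \<ge> 1 - 1 / real n ^ 2)"
    using gap_tail by (auto intro!: eventually_sequentiallyI[of 15000])
qed simp

end
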